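(* Let $n,q\in\mathbb{N}$ with $n\geqslant q+1$. Then the horizontal player $\mathcal{H}$ has a winning strategy for the $q$-double-response game on $S_{\infty\times n}$.
   Context: $S_{\infty\times n}$ is the infinite subgraph of the square lattice $\Lambda$ (on $\mathbb{Z}^2$, edges between points at Euclidean distance $1$) induced by $\{(x,y):x\in\mathbb{Z},y\in[n]\}$. The dual lattice $\Lambda^*$ has vertex set $\mathbb{Z}^2+(0.5,0.5)$ with edges between points at distance $1$; the dual $e^*$ of an edge $e$ is the dual edge with the same midpoint. A top-bottom crossing dual path is a path in $\Lambda^*$ all of whose dual edges are duals of edges of $S_{\infty\times n}$, joining a dual vertex with second coordinate $0.5$ to a dual vertex with second coordinate $n+0.5$. The $q$-double-response game is played by a vertical player $\mathcal{V}$ and a horizontal player $\mathcal{H}$ on the edges of $S_{\infty\times n}$, with $\mathcal{V}$ moving first: on each turn $t$, $\mathcal{V}$ chooses an integer $r_t\in[q]$ and claims $r_t$ as-yet unclaimed edges, and then $\mathcal{H}$ claims $2r_t$ as-yet unclaimed edges. $\mathcal{V}$ wins if at some point the duals of his claimed edges contain a top-bottom crossing dual path; $\mathcal{H}$ wins if this never happens. *)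

theory Defs
  imports "HOL-Analysis.Analysis"
begin

type_synonym point = "real \<times> real"
type_synonym edge = "point set"

definition unit_edges :: "point set \<Rightarrow> edge set" where
  "unit_edges P = {{u, v} | u v. u \<in> P \<and> v \<in> P \<and> dist u v = 1}"

definition square_lattice :: "point set" where
  "square_lattice = \<int> \<times> \<int>"

definition dual_lattice :: "point set" where
  "dual_lattice = (\<lambda>p. p + (1/2, 1/2)) ` square_lattice"

definition strip :: "nat \<Rightarrow> point set" where
  "strip n = \<int> \<times> real ` {1..n}"

definition strip_edges :: "nat \<Rightarrow> edge set" where
  "strip_edges n = {e \<in> unit_edges square_lattice. e \<subseteq> strip n}"

definition edge_mid :: "edge \<Rightarrow> point" where
  "edge_mid e = (1/2) *\<^sub>R (\<Sum>u\<in>e. u)"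

definition dual_edge :: "edge \<Rightarrow> edge" where
  "dual_edge e = (THE f. f \<in> unit_edges dual_lattice \<and> edge_mid f = edge_mid e)"

definition path_edges :: "point list \<Rightarrow> edge set" where
  "path_edges p = {{p ! i, p ! Suc i} | i. Suc i < length p}"

definition dual_path :: "point list \<Rightarrow> bool" where
  "dual_path p \<longleftrightarrow> p \<noteq> [] \<and> distinct p \<and> set p \<subseteq> dual_lattice
     \<and> path_edges p \<subseteq> unit_edges dual_lattice"

definition crossing_dual_path :: "nat \<Rightarrow> point list \<Rightarrow> bool" where
  "crossing_dual_path n p \<longleftrightarrow> dual_path p \<and> path_edges p \<subseteq> dual_edge ` strip_edges n
     \<and> snd (hd p) = 1/2 \<and> snd (last p) = real n + 1/2"

definition contains_crossing :: "nat \<Rightarrow> edge set \<Rightarrow> bool" where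
  "contains_crossing n F \<longleftrightarrow> (\<exists>p. crossing_dual_path n p \<and> path_edges p \<subseteq> dual_edge ` F)"

text \<open>A history lists the completed turns in chronological order; each entry is the set claimed
  by the vertical player in that turn together with the set claimed by the horizontal player in
  response.\<close>

type_synonym history = "(edge set \<times> edge set) list"

definition claimed_V :: "history \<Rightarrow> edge set" where
  "claimed_V h = \<Union> (fst ` set h)"

definition claimed_H :: "history \<Rightarrow> edge set" where
  "claimed_H h = \<Union> (snd ` set h)"

definition unclaimed :: "nat \<Rightarrow> history \<Rightarrow> edge set" where
  "unclaimed n h = strip_edges n - (claimed_V h \<union> claimed_H h)"

text \<open>The number \<open>r\<close> chosen by the vertical player in a turn is the cardinality of the set he
  claims. Since \<^const>\<open>card\<close> is 0 on infinite sets, legal moves of both players are finite.\<close>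

definition legal_V :: "nat \<Rightarrow> nat \<Rightarrow> history \<Rightarrow> edge set \<Rightarrow> bool" where
  "legal_V n q h v \<longleftrightarrow> v \<subseteq> unclaimed n h \<and> card v \<in> {1..q}"

definition legal_H :: "nat \<Rightarrow> history \<Rightarrow> edge set \<Rightarrow> edge set \<Rightarrow> bool" where
  "legal_H n h v w \<longleftrightarrow> w \<subseteq> unclaimed n h - v \<and> finite w \<and> card w = 2 * card v"

type_synonym strategy_H = "history \<Rightarrow> edge set \<Rightarrow> edge set"

inductive play_by :: "nat \<Rightarrow> nat \<Rightarrow> strategy_H \<Rightarrow> history \<Rightarrow> bool" for n q \<sigma> where
  start: "play_by n q \<sigma> []"
| turn: "play_by n q \<sigma> h \<Longrightarrow> legal_V n q h v \<Longrightarrow> play_by n q \<sigma> (h @ [(v, \<sigma> h v)])"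

text \<open>A winning strategy has to answer every legal move legally, and it has to prevent a crossing
  forever. Because the set claimed by the vertical player only grows, it is enough to look for a
  crossing after each of his moves.\<close>

definition winning_strategy_H :: "nat \<Rightarrow> nat \<Rightarrow> strategy_H \<Rightarrow> bool" where
  "winning_strategy_H n q \<sigma> \<longleftrightarrow>
     (\<forall>h v. play_by n q \<sigma> h \<and> legal_V n q h v \<longrightarrow>
        legal_H n h v (\<sigma> h v) \<and> \<not> contains_crossing n (claimed_V h \<union> v))"

text \<open>The definite description in the definition of \<^const>\<open>dual_edge\<close> is well defined.\<close>

lemma sum_sq_int_eq_1:
  fixes a b :: int
  assumes "a\<^sup>2 + b\<^sup>2 = 1"
  shows "(a = 0 \<and> \<bar>b\<bar> = 1) \<or> (\<bar>a\<bar> = 1 \<and> b = 0)"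
proof -
  have "\<bar>a\<bar> \<le> 1" "\<bar>b\<bar> \<le> 1"
    using assms abs_square_le_1[of a] abs_square_le_1[of b] zero_le_power2[of a] zero_le_power2[of b]
    by linarith+
  then have "a \<in> {-1,0,1}" "b \<in> {-1,0,1}" by auto
  then show ?thesis using assms by auto
qed

lemma dist_int_shift_eq_1:
  fixes a b c d :: int and s t :: real
  assumes "dist (of_int a + s, of_int b + t) (of_int c + s, of_int d + t) = 1"
  shows "(a = c \<and> \<bar>b - d\<bar> = 1) \<or> (\<bar>a - c\<bar> = 1 \<and> b = d)"
proof -
  have "(real_of_int a - of_int c)\<^sup>2 + (real_of_int b - of_int d)\<^sup>2 = 1"
    using assms by (simp add: dist_Pair_Pair dist_real_def)
  then have "real_of_int ((a - c)\<^sup>2 + (b - d)\<^sup>2) = of_int 1" by simp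
  then have "(a - c)\<^sup>2 + (b - d)\<^sup>2 = 1" by (simp only: of_int_eq_iff)
  from sum_sq_int_eq_1[OF this] show ?thesis by auto
qed

lemma lattice_edge_cases:
  assumes "e \<in> unit_edges square_lattice"
  obtains (horizontal) a b :: int where "e = {(of_int a, of_int b), (of_int a + 1, of_int b)}"
  | (vertical) a b :: int where "e = {(of_int a, of_int b), (of_int a, of_int b + 1)}"
proof -
  obtain a b c d :: int where e: "e = {(of_int a, of_int b), (of_int c, of_int d)}"
    and "dist (real_of_int a, real_of_int b) (of_int c, of_int d) = 1"
    using assms unfolding unit_edges_def square_lattice_def by (auto elim!: Ints_cases)
  then have "(a = c \<and> \<bar>b - d\<bar> = 1) \<or> (\<bar>a - c\<bar> = 1 \<and> b = d)"
    using dist_int_shift_eq_1[of a 0 b 0 c d] by simp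
  then consider "a = c" "d = b + 1" | "a = c" "b = d + 1" | "b = d" "c = a + 1" | "b = d" "a = c + 1"
    by linarith
  then show thesis
    by cases (use e in \<open>auto intro: horizontal[of a b] horizontal[of c d] vertical[of a b]
      vertical[of c d] simp: insert_commute\<close>)
qed

lemma dual_edge_cases:
  assumes "f \<in> unit_edges dual_lattice"
  obtains (horizontal) a b :: int where
    "f = {(of_int a + 1/2, of_int b + 1/2), (of_int a + 3/2, of_int b + 1/2)}"
  | (vertical) a b :: int where
    "f = {(of_int a + 1/2, of_int b + 1/2), (of_int a + 1/2, of_int b + 3/2)}"
proof -
  obtain a b c d :: int where f: "f = {(of_int a + 1/2, of_int b + 1/2), (of_int c + 1/2, of_int d + 1/2)}"
    and "dist (real_of_int a + 1/2, real_of_int b + 1/2) (of_int c + 1/2, of_int d + 1/2) = 1"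
    using assms unfolding unit_edges_def dual_lattice_def square_lattice_def by (auto elim!: Ints_cases)
  then have "(a = c \<and> \<bar>b - d\<bar> = 1) \<or> (\<bar>a - c\<bar> = 1 \<and> b = d)"
    using dist_int_shift_eq_1 by blast
  then consider "a = c" "d = b + 1" | "a = c" "b = d + 1" | "b = d" "c = a + 1" | "b = d" "a = c + 1"
    by linarith
  then show thesis
    by cases (use f in \<open>auto intro: horizontal[of a b] horizontal[of c d] vertical[of a b]
      vertical[of c d] simp: insert_commute add.assoc\<close>)
qed

lemma edge_mid_pair: "u \<noteq> v \<Longrightarrow> edge_mid {u, v} = (1/2) *\<^sub>R (u + v)"
  by (simp add: edge_mid_def)

lemma half_plus_int_neq: "real_of_int a \<noteq> of_int b + 1/2"
proof
  assume "real_of_int a = of_int b + 1/2"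
  then have "real_of_int (2 * a) = of_int (2 * b + 1)" by simp
  then have "2 * a = 2 * b + 1" by (simp only: of_int_eq_iff)
  then show False by presburger
qed

lemma dual_edge_eq_if_mid_eq:
  assumes "f \<in> unit_edges dual_lattice" "g \<in> unit_edges dual_lattice" "edge_mid f = edge_mid g"
  shows "f = g"
  using assms(1)
proof (cases rule: dual_edge_cases)
  case f: (horizontal a b)
  from assms(2) show ?thesis
  proof (cases rule: dual_edge_cases)
    case g: (horizontal c d)
    then show ?thesis using f assms(3) by (simp add: edge_mid_pair)
  next
    case g: (vertical c d)
    have "real_of_int a + 1 = of_int c + 1/2" using f g assms(3) by (simp add: edge_mid_pair)
    then show ?thesis using half_plus_int_neq[of "a + 1" c] by simp
  qed
next
  case f: (vertical a b)
  from assms(2) show ?thesis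
  proof (cases rule: dual_edge_cases)
    case g: (horizontal c d)
    have "real_of_int c + 1 = of_int a + 1/2" using f g assms(3) by (simp add: edge_mid_pair)
    then show ?thesis using half_plus_int_neq[of "c + 1" a] by simp
  next
    case g: (vertical c d)
    then show ?thesis using f assms(3) by (simp add: edge_mid_pair)
  qed
qed

lemma dualI:
  assumes "f \<in> unit_edges dual_lattice" "edge_mid f = edge_mid e"
  shows "dual_edge e = f"
  unfolding dual_edge_def using assms dual_edge_eq_if_mid_eq by (intro the_equality) metis+

lemma in_dual_lattice: "(of_int a + 1/2, of_int b + 1/2) \<in> dual_lattice"
  unfolding dual_lattice_def square_lattice_def
  by (rule image_eqI[where x = "(of_int a, of_int b)"]) auto

lemma dual_horizontal_edge:
  fixes a b :: int
  shows "dual_edge {(of_int a, of_int b), (of_int a + 1, of_int b)}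
       = {(of_int a + 1/2, of_int b - 1/2), (of_int a + 1/2, of_int b + 1/2)}" (is "dual_edge ?e = ?f")
    and "{(of_int a + 1/2, of_int b - 1/2), (of_int a + 1/2, of_int b + 1/2)}
       \<in> unit_edges dual_lattice"
proof -
  show f: "?f \<in> unit_edges dual_lattice"
    using in_dual_lattice[of a "b - 1"] in_dual_lattice[of a b]
    unfolding unit_edges_def by (force simp: dist_Pair_Pair dist_real_def)
  show "dual_edge ?e = ?f" by (rule dualI[OF f]) (simp add: edge_mid_pair)
qed

lemma dual_vertical_edge:
  fixes a b :: int
  shows "dual_edge {(of_int a, of_int b), (of_int a, of_int b + 1)}
       = {(of_int a - 1/2, of_int b + 1/2), (of_int a + 1/2, of_int b + 1/2)}" (is "dual_edge ?e = ?f")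
    and "{(of_int a - 1/2, of_int b + 1/2), (of_int a + 1/2, of_int b + 1/2)}
       \<in> unit_edges dual_lattice"
proof -
  show f: "?f \<in> unit_edges dual_lattice"
    using in_dual_lattice[of "a - 1" b] in_dual_lattice[of a b]
    unfolding unit_edges_def by (force simp: dist_Pair_Pair dist_real_def)
  show "dual_edge ?e = ?f" by (rule dualI[OF f]) (simp add: edge_mid_pair)
qed

lemma ex1_dual:
  assumes "e \<in> unit_edges square_lattice"
  shows "\<exists>!f. f \<in> unit_edges dual_lattice \<and> edge_mid f = edge_mid e"
proof -
  have "\<exists>f. f \<in> unit_edges dual_lattice \<and> edge_mid f = edge_mid e"
    using assms
  proof (cases rule: lattice_edge_cases)
    case (horizontal a b)
    show ?thesis
      by (rule exI, rule conjI, rule dual_horizontal_edge(2)[of a b])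
        (simp add: horizontal edge_mid_pair)
  next
    case (vertical a b)
    show ?thesis
      by (rule exI, rule conjI, rule dual_vertical_edge(2)[of a b])
        (simp add: vertical edge_mid_pair)
  qed
  then show ?thesis using dual_edge_eq_if_mid_eq by metis
qed

end

theory Submission
  imports Defs
begin

text \<open>The horizontal player keeps the dual graph partitioned into clusters such that every edge claimed
  by the vertical player lies inside a cluster, together with a level for each cluster: the bottom
  cluster has level 0, the top vertices have level at least \<open>n\<close>, and levels differ by at most 1 along
  unclaimed edges. Then \<open>q < n\<close> further edges cannot complete a crossing. A cluster behaves like a
  single vertex of the square lattice: it has at most 4 unclaimed outgoing edges, of which at most
  2 lead downwards. An edge between two clusters merges them at the higher of the two levels (raising
  a cluster only helps its neighbours); the merged cluster has up to 6 outgoing edges, and two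
  deletions restore the bounds. Several simultaneous claims are handled by merging first and
  deleting at the end, each merge granting a credit of two deletions. The bottom cluster
  cannot be raised, so everything that becomes connected to it is absorbed first; to keep this
  affordable, clusters of level 1 satisfy a finer bound in which left and right are
  distinguished.\<close>

section \<open>Deleting elements to restore cardinality bounds\<close>

lemma card_le_addI:
  assumes "X \<subseteq> Y \<union> Z" "finite Y" "finite Z" "card Y \<le> i" "card Z \<le> j" "i + j \<le> m"
  shows "card X \<le> m"
proof -
  have "card X \<le> card (Y \<union> Z)" using assms(1-3) by (intro card_mono) auto
  also have "\<dots> \<le> card Y + card Z" by (rule card_Un_le)
  finally show ?thesis using assms by linarith
qed

lemma obtain_part:
  assumes "finite Y"
  obtains X where "X \<subseteq> Y" "card X \<le> k" "card (Y - X) \<le> card Y - k"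
proof -
  obtain X where X: "X \<subseteq> Y" "card X = min k (card Y)"
    using obtain_subset_with_card_n[of "min k (card Y)" Y] by auto
  then have "card (Y - X) = card Y - card X"
    using assms by (intro card_Diff_subset) (auto intro: finite_subset)
  then show thesis using that X by auto
qed

text \<open>Used for clusters of level 1, with \<open>G\<close> and \<open>H\<close> the sets
  \<open>ins\<close> and \<open>mid\<close>: spend \<open>k\<close> deletions on each, then whatever
  an overlap or a small set has saved of the \<open>2 * k\<close> on the rest of
  \<open>O'\<close>.\<close>

lemma remove_overlapping:
  assumes "finite O'" "G \<subseteq> O'" "H \<subseteq> O'" "card G \<le> k + 2" "card H \<le> k + 2" "card O' \<le> 2 * k + 4"
  obtains X where "X \<subseteq> O'" "card X \<le> 2 * k" "card (G - X) \<le> 2" "card (H - X) \<le> 2" "card (O' - X) \<le> 4"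
proof -
  have fin: "finite G" "finite H" using assms finite_subset by auto
  obtain X where X: "X \<subseteq> G" "card X \<le> k" "card (G - X) \<le> card G - k" using obtain_part[OF fin(1)] .
  obtain Y where Y: "Y \<subseteq> H" "card Y \<le> k" "card (H - Y) \<le> card H - k" using obtain_part[OF fin(2)] .
  have sub: "X \<union> Y \<subseteq> O'" using X Y assms by auto
  have finXY: "finite (X \<union> Y)" using sub assms(1) finite_subset by auto
  have cXY: "card (X \<union> Y) \<le> 2 * k" using card_Un_le[of X Y] X Y by linarith
  obtain Z where Z: "Z \<subseteq> O' - (X \<union> Y)" "card Z \<le> 2 * k - card (X \<union> Y)"
    "card (O' - (X \<union> Y) - Z) \<le> card (O' - (X \<union> Y)) - (2 * k - card (X \<union> Y))"
    using obtain_part[of "O' - (X \<union> Y)"] assms(1) by blast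
  have "card (O' - (X \<union> Y)) = card O' - card (X \<union> Y)" by (rule card_Diff_subset[OF finXY sub])
  then have "card (O' - (X \<union> Y) - Z) \<le> 4" using Z(3) assms(6) cXY by linarith
  moreover have "O' - (X \<union> Y) - Z = O' - (X \<union> Y \<union> Z)" by auto
  moreover have "card (G - (X \<union> Y \<union> Z)) \<le> card (G - X)" using fin by (intro card_mono) auto
  moreover have "card (H - (X \<union> Y \<union> Z)) \<le> card (H - Y)" using fin by (intro card_mono) auto
  moreover have "card (X \<union> Y \<union> Z) \<le> 2 * k" using card_Un_le[of "X \<union> Y" Z] Z(2) cXY by linarith
  moreover have "X \<union> Y \<union> Z \<subseteq> O'" using sub Z by auto
  ultimately show thesis using that[of "X \<union> Y \<union> Z"] X(3) Y(3) assms(4,5) by auto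
qed

text \<open>Used above level 1, with \<open>F\<close>, \<open>G\<close> the sets \<open>bad\<close>
  and \<open>below\<close>: first all of \<open>F\<close>, then elements of \<open>G\<close>, then
  of \<open>O'\<close>. One deletion counts for every larger set of the chain.\<close>

lemma remove_nested:
  assumes "finite O'" "F \<subseteq> G" "G \<subseteq> O'" "card F \<le> k" "card G \<le> k + 2" "card O' \<le> k + 4"
  obtains X where "X \<subseteq> O'" "card X \<le> k" "F \<subseteq> X" "card (G - X) \<le> 2" "card (O' - X) \<le> 4"
proof -
  have fin: "finite F" "finite G" using assms finite_subset by (metis, metis)
  obtain X where X: "X \<subseteq> G - F" "card X \<le> k - card F" "card (G - F - X) \<le> card (G - F) - (k - card F)"
    using obtain_part[of "G - F"] fin by blast
  have "card (G - F) = card G - card F" using fin assms(2) by (intro card_Diff_subset)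
  then have G: "card (G - F - X) \<le> 2" using X(3) assms(4,5) by linarith
  have sub: "F \<union> X \<subseteq> O'" using X assms by auto
  have finFX: "finite (F \<union> X)" using sub assms(1) finite_subset by auto
  have cFX: "card (F \<union> X) \<le> k" using card_Un_le[of F X] X assms(4) by linarith
  obtain Z where Z: "Z \<subseteq> O' - (F \<union> X)" "card Z \<le> k - card (F \<union> X)"
    "card (O' - (F \<union> X) - Z) \<le> card (O' - (F \<union> X)) - (k - card (F \<union> X))"
    using obtain_part[of "O' - (F \<union> X)"] assms(1) by blast
  have "card (O' - (F \<union> X)) = card O' - card (F \<union> X)" by (rule card_Diff_subset[OF finFX sub])
  then have "card (O' - (F \<union> X) - Z) \<le> 4" using Z(3) assms(6) cFX by linarith
  moreover have "O' - (F \<union> X) - Z = O' - (F \<union> X \<union> Z)" by auto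
  moreover have "card (G - (F \<union> X \<union> Z)) \<le> card (G - F - X)" using fin by (intro card_mono) auto
  moreover have "card (F \<union> X \<union> Z) \<le> k" using card_Un_le[of "F \<union> X" Z] Z(2) cFX by linarith
  moreover have "F \<union> X \<union> Z \<subseteq> O'" using sub Z by auto
  ultimately show thesis using that[of "F \<union> X \<union> Z"] G by auto
qed

section \<open>Clusters, levels and degree bounds\<close>

text \<open>In the strip, edges are oriented from \<open>src\<close> to \<open>tgt\<close> upwards
  or to the right. Levels belong to labels, so a merge is a mere relabelling; a label that no vertex
  carries is an empty cluster.\<close>

locale levelled_graph =
  fixes src tgt :: "'e \<Rightarrow> 'p" and hor :: "'e \<Rightarrow> bool" and B :: 'l and lev :: "'l \<Rightarrow> nat"
  assumes lev_B: "lev r = 0 \<longleftrightarrow> r = B"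
begin

definition out :: "'e set \<Rightarrow> ('p \<Rightarrow> 'l) \<Rightarrow> 'l \<Rightarrow> 'e set" where
  "out U cl r = {e \<in> U. (cl (src e) = r) \<noteq> (cl (tgt e) = r)}"

definition far :: "('p \<Rightarrow> 'l) \<Rightarrow> 'l \<Rightarrow> 'e \<Rightarrow> 'l" where
  "far cl r e = (if cl (src e) = r then cl (tgt e) else cl (src e))"

definition below :: "'e set \<Rightarrow> ('p \<Rightarrow> 'l) \<Rightarrow> 'l \<Rightarrow> 'e set" where
  "below U cl r = {e \<in> out U cl r. lev (far cl r e) < lev r}"

text \<open>The second kind of bad edge joins a cluster of level at least 2 to a left neighbour of level 1. If
  it were kept, then absorbing that neighbour into the bottom cluster would cost an extra deletion.\<close>

definition bad :: "'e set \<Rightarrow> ('p \<Rightarrow> 'l) \<Rightarrow> 'l \<Rightarrow> 'e set" where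
  "bad U cl r = {e \<in> out U cl r. lev (far cl r e) + 2 \<le> lev r
      \<or> hor e \<and> cl (tgt e) = r \<and> lev (far cl r e) = 1}"

text \<open>The edges to the left and below. Only these edges of a level-1 cluster can turn bad when
  it is merged into a cluster of level 2.\<close>

definition ins :: "'e set \<Rightarrow> ('p \<Rightarrow> 'l) \<Rightarrow> 'l \<Rightarrow> 'e set" where
  "ins U cl r = {e \<in> out U cl r. cl (tgt e) = r}"

text \<open>The edges to the left and above. Only these edges of a settled level-1 cluster can
  become \<open>loose\<close> when it is absorbed into the bottom cluster.\<close>

definition mid :: "'e set \<Rightarrow> ('p \<Rightarrow> 'l) \<Rightarrow> 'l \<Rightarrow> 'e set" where
  "mid U cl r = {e \<in> out U cl r. cl (tgt e) = r \<longleftrightarrow> hor e}"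

text \<open>The credit \<open>k\<close> is the number of merges whose two deletions have not been carried out yet.\<close>

definition tame :: "'e set \<Rightarrow> ('p \<Rightarrow> 'l) \<Rightarrow> nat \<Rightarrow> 'l \<Rightarrow> bool" where
  "tame U cl k r \<longleftrightarrow> finite (out U cl r) \<and> card (out U cl r) \<le> 2 * k + 4 \<and>
    (if lev r = 1
     then card (ins U cl r) \<le> k + 2 \<and> card (mid U cl r) \<le> k + 2
       \<and> (\<forall>e \<in> ins U cl r. \<not> hor e \<longrightarrow> cl (src e) = B)
     else card (bad U cl r) \<le> 2 * k \<and> card (below U cl r) \<le> 2 * k + 2)"

text \<open>The last clause orients all edges at the bottom cluster away from it, so a level-0
  neighbour is only ever met through an edge of \<open>ins\<close>.\<close>

definition indebted :: "'e set \<Rightarrow> ('p \<Rightarrow> 'l) \<Rightarrow> ('l \<Rightarrow> nat) \<Rightarrow> bool" where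
  "indebted U cl k \<longleftrightarrow> (\<forall>r. r \<noteq> B \<longrightarrow> tame U cl (k r) r) \<and> (\<forall>e \<in> out U cl B. cl (src e) = B)"

abbreviation settled :: "'e set \<Rightarrow> ('p \<Rightarrow> 'l) \<Rightarrow> bool" where
  "settled U cl \<equiv> indebted U cl (\<lambda>_. 0)"

lemma subs: "below U cl r \<subseteq> out U cl r" "bad U cl r \<subseteq> out U cl r" "ins U cl r \<subseteq> out U cl r"
    "mid U cl r \<subseteq> out U cl r"
  by (auto simp: below_def bad_def ins_def mid_def)

lemma bad_below:
  assumes "r \<noteq> B" "lev r \<noteq> 1"
  shows "bad U cl r \<subseteq> below U cl r"
  using assms lev_B[of r] by (auto simp: bad_def below_def)

lemma tame_antimono:
  assumes "tame U cl k r" "U' \<subseteq> U"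
  shows "tame U' cl k r"
proof -
  have sub: "out U' cl r \<subseteq> out U cl r" "ins U' cl r \<subseteq> ins U cl r" "mid U' cl r \<subseteq> mid U cl r"
    "bad U' cl r \<subseteq> bad U cl r" "below U' cl r \<subseteq> below U cl r"
    using assms(2) by (auto simp: out_def ins_def mid_def bad_def below_def)
  have "finite (out U cl r)" using assms by (simp add: tame_def)
  then have fin: "finite (out U cl r)" "finite (ins U cl r)" "finite (mid U cl r)" "finite (bad U cl r)"
    "finite (below U cl r)"
    using subs[of U cl r] by (auto intro: finite_subset)
  show ?thesis
    using assms(1) sub card_mono[OF fin(1) sub(1)] card_mono[OF fin(2) sub(2)] card_mono[OF fin(3) sub(3)]
      card_mono[OF fin(4) sub(4)] card_mono[OF fin(5) sub(5)] finite_subset[OF sub(1) fin(1)]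
    unfolding tame_def by (smt (verit) le_trans subsetD)
qed

lemma settled_antimono: "settled U cl \<Longrightarrow> U' \<subseteq> U \<Longrightarrow> settled U' cl"
  unfolding indebted_def by (auto intro: tame_antimono simp: out_def)

section \<open>Merging clusters away from the bottom\<close>

text \<open>The joining edge leaves both boundaries, so the bounds on \<open>out\<close> add up to
  (2 k u + 3) + (2 k v + 3) = 2 (k u + k v + 1) + 4: one new unit of credit suffices. The other
  bounds are checked by comparing the two levels. Third clusters only see a neighbour rise.\<close>

lemma merge:
  assumes ind: "indebted U cl k" and e: "e \<in> U" "cl (src e) \<noteq> cl (tgt e)"
    "{cl (src e), cl (tgt e)} = {u, v}"
    and uv: "u \<noteq> B" "v \<noteq> B" "lev u \<le> lev v"
  shows "indebted U (\<lambda>p. if cl p = u then v else cl p) (k(u := 0, v := k u + k v + 1))"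
    (is "indebted U ?cl ?k")
proof -
  have neq: "u \<noteq> v" using e by auto
  have tm: "tame U cl (k r) r" if "r \<noteq> B" for r using ind that by (simp add: indebted_def)
  note tu = tm[OF uv(1)] and tv = tm[OF uv(2)]
  have eo: "e \<in> out U cl u" "e \<in> out U cl v" using e neq by (auto simp: out_def doubleton_eq_iff)
  have fo: "finite (out U cl u)" "finite (out U cl v)" using tu tv by (auto simp: tame_def)
  then have fin: "finite (bad U cl v)" "finite (below U cl v)" "finite (bad U cl u)" "finite (below U cl u)"
    "finite (ins U cl v)" "finite (mid U cl v)" "finite (ins U cl u)" "finite (mid U cl u)"
    using subs finite_subset by meson+
  have co: "card (out U cl u) \<le> 2 * k u + 4" "card (out U cl v) \<le> 2 * k v + 4"
    using tu tv by (auto simp: tame_def)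
  have coe: "card (out U cl u - {e}) \<le> 2 * k u + 3" "card (out U cl v - {e}) \<le> 2 * k v + 3"
    using co eo fo by auto
  have outv: "out U ?cl v \<subseteq> (out U cl u - {e}) \<union> (out U cl v - {e})"
    using e neq by (auto simp: out_def split: if_splits)
  have farv: "far ?cl v f = far cl v f" if "f \<in> out U ?cl v" "f \<in> out U cl v" for f
    using that neq by (auto simp: out_def far_def split: if_splits)
  have faru: "far ?cl v f = far cl u f" if "f \<in> out U ?cl v" "f \<in> out U cl u" for f
    using that neq by (auto simp: out_def far_def split: if_splits)
  have "tame U ?cl (?k v) v"
  proof -
    have 1: "finite (out U ?cl v)" using outv fo finite_subset by blast
    have 2: "card (out U ?cl v) \<le> 2 * ?k v + 4"
      using fo by (intro card_le_addI[OF outv _ _ coe]) auto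
    show ?thesis
    proof (cases "lev v = 1")
      case True
      then have lu: "lev u = 1" using uv lev_B[of u] by linarith
      have iu: "card (ins U cl u) \<le> k u + 2" "card (mid U cl u) \<le> k u + 2"
        "\<And>f. f \<in> ins U cl u \<Longrightarrow> \<not> hor f \<Longrightarrow> cl (src f) = B"
        using tu lu by (auto simp: tame_def)
      have iv: "card (ins U cl v) \<le> k v + 2" "card (mid U cl v) \<le> k v + 2"
        "\<And>f. f \<in> ins U cl v \<Longrightarrow> \<not> hor f \<Longrightarrow> cl (src f) = B"
        using tv True by (auto simp: tame_def)
      \<comment> \<open>A non-horizontal edge into a level-1 cluster starts in the bottom cluster,
        and neither end of \<open>e\<close> lies there.\<close>
      have h: "hor e" using iu(3)[of e] iv(3)[of e] eo e uv by (auto simp: ins_def doubleton_eq_iff)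
      have insv: "ins U ?cl v \<subseteq> (ins U cl u - {e}) \<union> (ins U cl v - {e})"
        using outv by (auto simp: ins_def out_def split: if_splits)
      have midv: "mid U ?cl v \<subseteq> (mid U cl u - {e}) \<union> (mid U cl v - {e})"
        using outv by (auto simp: mid_def out_def split: if_splits)
      \<comment> \<open>Being horizontal, \<open>e\<close> is in both \<open>ins\<close> and
        \<open>mid\<close> of the cluster holding its target, which saves one in each sum: (k u + 2)
        + (k v + 2) - 1 = (k u + k v + 1) + 2.\<close>
      have "card (ins U ?cl v) \<le> k u + k v + 3 \<and> card (mid U ?cl v) \<le> k u + k v + 3"
      proof (cases "cl (tgt e) = v")
        case True
        then have "e \<in> ins U cl v" "e \<in> mid U cl v" using eo h by (auto simp: ins_def mid_def)
        then have 3: "card (ins U cl v - {e}) \<le> k v + 1" "card (mid U cl v - {e}) \<le> k v + 1"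
          using iv fin by auto
        have 4: "card (ins U cl u - {e}) \<le> k u + 2" "card (mid U cl u - {e}) \<le> k u + 2"
          using iu card_Diff1_le[of _ e] le_trans by blast+
        show ?thesis using fin
          by (auto intro!: card_le_addI[OF insv _ _ 4(1) 3(1)] card_le_addI[OF midv _ _ 4(2) 3(2)])
      next
        case False
        then have "cl (tgt e) = u" using e by auto
        then have "e \<in> ins U cl u" "e \<in> mid U cl u" using eo h by (auto simp: ins_def mid_def)
        then have 3: "card (ins U cl u - {e}) \<le> k u + 1" "card (mid U cl u - {e}) \<le> k u + 1"
          using iu fin by auto
        have 4: "card (ins U cl v - {e}) \<le> k v + 2" "card (mid U cl v - {e}) \<le> k v + 2"
          using iv card_Diff1_le[of _ e] le_trans by blast+
        show ?thesis using fin
          by (auto intro!: card_le_addI[OF insv _ _ 3(1) 4(1)] card_le_addI[OF midv _ _ 3(2) 4(2)])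
      qed
      moreover have "?cl (src f) = B" if "f \<in> ins U ?cl v" "\<not> hor f" for f
        using that insv iu(3) iv(3) uv by fastforce
      ultimately show ?thesis using 1 2 True by (auto simp: tame_def)
    next
      case False
      have cv: "card (bad U cl v) \<le> 2 * k v" "card (below U cl v) \<le> 2 * k v + 2"
        using tv False by (auto simp: tame_def)
      have farev: "far cl v e = u" using e neq by (auto simp: far_def doubleton_eq_iff)
      \<comment> \<open>Edges inherited from \<open>v\<close> keep their status; those inherited
        from \<open>u\<close> are now measured against the level of \<open>v\<close>.\<close>
      have splitb: "bad U ?cl v \<subseteq> (bad U ?cl v \<inter> (out U cl u - {e})) \<union> (bad U cl v - {e})"
        using outv farv by (auto simp: bad_def split: if_splits) (auto simp: out_def)
      have splitw: "below U ?cl v \<subseteq> (below U ?cl v \<inter> (out U cl u - {e})) \<union> (below U cl v - {e})"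
        using outv farv by (auto simp: below_def)
      have "card (bad U ?cl v) \<le> 2 * ?k v \<and> card (below U ?cl v) \<le> 2 * ?k v + 2"
      proof (cases "lev u = lev v")
        case True
        have cu: "card (bad U cl u) \<le> 2 * k u" "card (below U cl u) \<le> 2 * k u + 2"
          using tu False True by (auto simp: tame_def)
        have "bad U ?cl v \<inter> (out U cl u - {e}) \<subseteq> bad U cl u"
          using faru True by (auto simp: bad_def out_def split: if_splits)
        then have b: "bad U ?cl v \<subseteq> bad U cl u \<union> bad U cl v" using splitb by auto
        have "below U ?cl v \<inter> (out U cl u - {e}) \<subseteq> below U cl u"
          using faru True by (auto simp: below_def)
        then have w: "below U ?cl v \<subseteq> below U cl u \<union> below U cl v" using splitw by auto
        show ?thesis using cu cv fin
          by (auto intro!: card_le_addI[OF b _ _ cu(1) cv(1)] card_le_addI[OF w _ _ cu(2) cv(2)])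
      next
        case diff: False
        then have less: "lev u < lev v" using uv by simp
        then have ew: "e \<in> below U cl v" using eo farev by (simp add: below_def)
        \<comment> \<open>Every edge inherited from \<open>u\<close> may now lead downwards, but
          \<open>e\<close>, which led down from \<open>v\<close>, is gone: (2 k u + 3) + (2 k v + 1)
          meets the bound.\<close>
        have w: "below U ?cl v \<subseteq> (out U cl u - {e}) \<union> (below U cl v - {e})" using splitw by auto
        have "card (below U cl v - {e}) \<le> 2 * k v + 1" using ew cv(2) fin by auto
        then have W: "card (below U ?cl v) \<le> 2 * ?k v + 2"
          using coe fo fin by (intro card_le_addI[OF w, where i = "2 * k u + 3" and j = "2 * k v + 1"]) auto
        have "card (bad U ?cl v) \<le> 2 * ?k v"
        proof (cases "lev v \<ge> lev u + 2")
          case True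
          \<comment> \<open>Here \<open>e\<close> itself was bad for \<open>v\<close>. This saves
            one, and it forces \<open>k v\<close> to be positive, so that \<open>2 * k v - 1\<close>
            below is not truncated.\<close>
          then have eb: "e \<in> bad U cl v" using eo farev by (simp add: bad_def)
          then have "card (bad U cl v) > 0" using fin by (auto simp: card_gt_0_iff)
          then have "card (bad U cl v - {e}) + 1 \<le> 2 * k v" using eb cv(1) fin by auto
          moreover have "bad U ?cl v \<subseteq> (out U cl u - {e}) \<union> (bad U cl v - {e})" using splitb by auto
          ultimately show ?thesis using coe fo fin neq
            by - (rule card_le_addI[of _ "out U cl u - {e}" "bad U cl v - {e}" "2 * k u + 3" "2 * k v - 1"],
              simp_all)
        next
          case False
          then have lv: "lev v = lev u + 1" using less by simp
          \<comment> \<open>At a gap of 1, not all of \<open>out U cl u\<close> can turn bad: only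
            \<open>ins\<close> if \<open>u\<close> has level 1, and only \<open>below\<close>
            otherwise.\<close>
          have "\<exists>Y. finite Y \<and> card Y \<le> 2 * k u + 2 \<and> bad U ?cl v \<inter> (out U cl u - {e}) \<subseteq> Y"
          proof (cases "lev u = 1")
            case True
            have iu: "card (ins U cl u) \<le> k u + 2" using tu True by (auto simp: tame_def)
            have "bad U ?cl v \<inter> (out U cl u - {e}) \<subseteq> ins U cl u"
            proof
              fix f assume f: "f \<in> bad U ?cl v \<inter> (out U cl u - {e})"
              then have fb: "f \<in> out U ?cl v" "f \<in> out U cl u" by (auto simp: bad_def)
              \<comment> \<open>An edge out of \<open>u\<close> could be bad only by ending at level
                0, against the orientation of the edges at \<open>B\<close>.\<close>
              have "cl (tgt f) = u"
              proof (rule ccontr)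
                assume n: "cl (tgt f) \<noteq> u"
                then have s: "cl (src f) = u" "far cl u f = cl (tgt f)" using fb by (auto simp: out_def far_def)
                then have "cl (tgt f) \<noteq> v" using fb by (auto simp: out_def)
                then have "lev (cl (tgt f)) = 0" using f n s faru[OF fb] lv True by (auto simp: bad_def)
                then have "cl (tgt f) = B" by (simp add: lev_B)
                then have "f \<in> out U cl B" using fb s uv by (auto simp: out_def)
                then have "cl (src f) = B" using ind by (simp add: indebted_def)
                then show False using s uv by simp
              qed
              then show "f \<in> ins U cl u" using fb by (simp add: ins_def)
            qed
            then show ?thesis using iu fin by (intro exI[of _ "ins U cl u"]) auto
          next
            case False
            then have "lev u \<ge> 2" using uv lev_B[of u] by linarith
            then have "bad U ?cl v \<inter> (out U cl u - {e}) \<subseteq> below U cl u"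
              using faru lv by (auto simp: bad_def below_def)
            moreover have "card (below U cl u) \<le> 2 * k u + 2" using tu False by (auto simp: tame_def)
            ultimately show ?thesis using fin by (intro exI[of _ "below U cl u"]) auto
          qed
          then obtain Y where Y: "finite Y" "card Y \<le> 2 * k u + 2"
            "bad U ?cl v \<inter> (out U cl u - {e}) \<subseteq> Y" by blast
          have "bad U ?cl v \<subseteq> Y \<union> bad U cl v" using splitb Y(3) by auto
          then show ?thesis using Y cv fin by - (rule card_le_addI[OF _ _ _ Y(2) cv(1)], auto)
        qed
        then show ?thesis using W by simp
      qed
      then show ?thesis using 1 2 False by (auto simp: tame_def)
    qed
  qed
  moreover have "tame U ?cl (?k u) u"
  proof -
    have "out U ?cl u = {}" using neq by (auto simp: out_def split: if_splits)
    then show ?thesis using neq by (simp add: tame_def ins_def mid_def bad_def below_def)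
  qed
  moreover have "tame U ?cl (?k r) r" if r: "r \<noteq> B" "r \<noteq> u" "r \<noteq> v" for r
  proof -
    have o: "out U ?cl r = out U cl r" using r by (auto simp: out_def)
    \<comment> \<open>Since \<open>u\<close> and \<open>v\<close> differ from \<open>B\<close>, the
      merge neither creates nor destroys level 0. So a neighbour at level 1 after the merge was at
      level 1 before, and no edge turns bad.\<close>
    have l: "lev (far cl r f) \<le> lev (far ?cl r f)" "lev (far cl r f) = 0 \<longleftrightarrow> lev (far ?cl r f) = 0" for f
      using uv r by (auto simp: far_def lev_B)
    have i: "ins U ?cl r = ins U cl r" "mid U ?cl r = mid U cl r" unfolding ins_def mid_def o using r by auto
    have w: "below U ?cl r \<subseteq> below U cl r" unfolding below_def o using l(1) by (auto intro: le_less_trans)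
    have b: "bad U ?cl r \<subseteq> bad U cl r"
    proof
      fix f assume f: "f \<in> bad U ?cl r"
      have "lev (far ?cl r f) = 1 \<Longrightarrow> lev (far cl r f) = 1" using l[of f] by linarith
      moreover have "lev (far ?cl r f) + 2 \<le> lev r \<Longrightarrow> lev (far cl r f) + 2 \<le> lev r"
        using l(1)[of f] by linarith
      moreover have "?cl (tgt f) = r \<Longrightarrow> cl (tgt f) = r" using r by (simp split: if_splits)
      ultimately show "f \<in> bad U cl r" using f unfolding bad_def o by blast
    qed
    have t: "tame U cl (k r) r" using tm r by blast
    then have f: "finite (out U cl r)" by (simp add: tame_def)
    have "card (below U ?cl r) \<le> card (below U cl r)" "card (bad U ?cl r) \<le> card (bad U cl r)"
      using w b f finite_subset[OF subs(1)] finite_subset[OF subs(2)] by (auto intro!: card_mono)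
    then show ?thesis using t r uv unfolding tame_def o i by (auto simp: ins_def)
  qed
  moreover have "out U ?cl B = out U cl B" using uv by (auto simp: out_def)
  ultimately show ?thesis using ind uv neq by (auto simp: indebted_def)
qed

text \<open>Induction over the claimed edges, each causing at most one merge. The finite set
  \<open>R\<close> carries all credit, so that the total is a sum; merges leave the boundary of
  \<open>B\<close> untouched, so \<open>P\<close> keeps avoiding it.\<close>

lemma merge_all:
  assumes "finite P" "indebted U cl k" "P \<subseteq> U" "P \<inter> out U cl B = {}" "finite R" "\<forall>r. r \<notin> R \<longrightarrow> k r = 0"
  shows "\<exists>cl' k' R'. indebted U cl' k' \<and> finite R' \<and> (\<forall>r. r \<notin> R' \<longrightarrow> k' r = 0) \<and>
    sum k' R' \<le> sum k R + card P \<and> (\<forall>p q. cl p = cl q \<longrightarrow> cl' p = cl' q) \<and>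
    (\<forall>e \<in> P. cl' (src e) = cl' (tgt e)) \<and> (\<forall>p. cl p = B \<longrightarrow> cl' p = B) \<and>
    (\<forall>p. lev (cl p) \<le> lev (cl' p))"
  using assms
proof (induction P arbitrary: cl k R rule: finite_induct)
  case empty
  then show ?case by (intro exI[of _ cl] exI[of _ k] exI[of _ R]) simp
next
  case (insert e P)
  have PU: "P \<subseteq> U" "e \<in> U" and Pe: "P \<inter> out U cl B = {}" "e \<notin> out U cl B" using insert.prems by auto
  show ?case
  proof (cases "cl (src e) = cl (tgt e)")
    \<comment> \<open>Both ends already share a cluster, so no credit is granted.\<close>
    case True
    obtain cl' k' R' where IH: "indebted U cl' k'" "finite R'" "\<forall>r. r \<notin> R' \<longrightarrow> k' r = 0"
      "sum k' R' \<le> sum k R + card P" "\<forall>p q. cl p = cl q \<longrightarrow> cl' p = cl' q"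
      "\<forall>e \<in> P. cl' (src e) = cl' (tgt e)" "\<forall>p. cl p = B \<longrightarrow> cl' p = B"
      "\<forall>p. lev (cl p) \<le> lev (cl' p)"
      using insert.IH[OF insert.prems(1) PU(1) Pe(1) insert.prems(4,5)] by blast
    have "\<forall>f \<in> insert e P. cl' (src f) = cl' (tgt f)" using IH(5,6) True by blast
    moreover have "sum k' R' \<le> sum k R + card (insert e P)" using IH(4) insert.hyps by simp
    ultimately show ?thesis using IH(1-3,5,7,8) by blast
  next
    case False
    obtain u v where uv: "{cl (src e), cl (tgt e)} = {u, v}" "lev u \<le> lev v"
      by (metis insert_commute nle_le)
    have nB: "u \<noteq> B" "v \<noteq> B" "u \<noteq> v" using uv False Pe PU by (auto simp: out_def doubleton_eq_iff)
    define cl1 where "cl1 = (\<lambda>p. if cl p = u then v else cl p)"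
    define k1 where "k1 = k(u := 0, v := k u + k v + 1)"
    have ind: "indebted U cl1 k1" unfolding cl1_def k1_def
      using merge[OF insert.prems(1) PU(2) False uv(1) nB(1,2) uv(2)] .
    have "out U cl1 B = out U cl B" using nB by (auto simp: out_def cl1_def)
    then have disj: "P \<inter> out U cl1 B = {}" using Pe by simp
    define R1 where "R1 = insert u (insert v R)"
    \<comment> \<open>Adding \<open>u\<close> and \<open>v\<close> to the support changes nothing,
      because credit outside \<open>R\<close> is 0; pooling the two credits then adds exactly
      one.\<close>
    have "sum k R1 = sum k R"
      using insert.prems(4,5) by (intro sum.mono_neutral_right) (auto simp: R1_def)
    moreover have "R1 = insert u (insert v (R - {u, v}))" by (auto simp: R1_def)
    ultimately have sum: "sum k1 R1 = sum k R + 1"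
      using nB(3) insert.prems(4) by (auto simp: k1_def)
    have R1: "finite R1" "\<forall>r. r \<notin> R1 \<longrightarrow> k1 r = 0"
      using insert.prems(4,5) by (auto simp: R1_def k1_def)
    obtain cl' k' R' where IH: "indebted U cl' k'" "finite R'" "\<forall>r. r \<notin> R' \<longrightarrow> k' r = 0"
      "sum k' R' \<le> sum k1 R1 + card P" "\<forall>p q. cl1 p = cl1 q \<longrightarrow> cl' p = cl' q"
      "\<forall>e \<in> P. cl' (src e) = cl' (tgt e)" "\<forall>p. cl1 p = B \<longrightarrow> cl' p = B"
      "\<forall>p. lev (cl1 p) \<le> lev (cl' p)"
      using insert.IH[OF ind PU(1) disj R1] by blast
    have e1: "cl1 (src e) = cl1 (tgt e)" using uv(1) by (auto simp: cl1_def doubleton_eq_iff)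
    have "sum k' R' \<le> sum k R + card (insert e P)" using IH(4) sum insert.hyps by simp
    moreover
    have "cl p = cl q \<Longrightarrow> cl1 p = cl1 q" for p q by (simp add: cl1_def)
    then have "\<forall>p q. cl p = cl q \<longrightarrow> cl' p = cl' q" using IH(5) by blast
    moreover have "\<forall>p. cl p = B \<longrightarrow> cl' p = B" using IH(7) nB by (simp add: cl1_def)
    moreover have "\<forall>f \<in> insert e P. cl' (src f) = cl' (tgt f)" using IH(5,6) e1 by blast
    moreover
    have "lev (cl p) \<le> lev (cl1 p)" for p using uv(2) by (simp add: cl1_def)
    then have "\<forall>p. lev (cl p) \<le> lev (cl' p)" using IH(8) order_trans by blast
    ultimately show ?thesis using IH(1-3) by blast
  qed
qed

section \<open>Spending the credit\<close>

lemma pay_cluster: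
  assumes "tame U cl k r" "r \<noteq> B"
  obtains X where "X \<subseteq> out U cl r" "card X \<le> 2 * k" "tame (U - X) cl 0 r"
proof -
  have fin: "finite (out U cl r)" and c: "card (out U cl r) \<le> 2 * k + 4"
    using assms by (auto simp: tame_def)
  have D: "out (U - X) cl r = out U cl r - X" "ins (U - X) cl r = ins U cl r - X"
    "mid (U - X) cl r = mid U cl r - X" "bad (U - X) cl r = bad U cl r - X"
    "below (U - X) cl r = below U cl r - X" for X
    by (auto simp: out_def ins_def mid_def bad_def below_def)
  show thesis
  proof (cases "lev r = 1")
    case True
    then have "card (ins U cl r) \<le> k + 2" "card (mid U cl r) \<le> k + 2"
      using assms by (auto simp: tame_def)
    from remove_overlapping[OF fin subs(3,4) this c]
    obtain X where "X \<subseteq> out U cl r" "card X \<le> 2 * k" "card (ins U cl r - X) \<le> 2"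
      "card (mid U cl r - X) \<le> 2" "card (out U cl r - X) \<le> 4" .
    then show thesis using True assms fin by (intro that[of X]) (auto simp: tame_def D)
  next
    case False
    then have "card (bad U cl r) \<le> 2 * k" "card (below U cl r) \<le> 2 * k + 2"
      using assms by (auto simp: tame_def)
    from remove_nested[OF fin bad_below[OF assms(2) False] subs(1) this c]
    obtain X where "X \<subseteq> out U cl r" "card X \<le> 2 * k" "bad U cl r \<subseteq> X"
      "card (below U cl r - X) \<le> 2" "card (out U cl r - X) \<le> 4" .
    then show thesis using False assms fin
      by (intro that[of X]) (auto simp: tame_def D Diff_eq_empty_iff[THEN iffD2])
  qed
qed

text \<open>Each cluster pays on its own; deletions made for other clusters do no harm by
  \<open>tame_antimono\<close>. All deleted edges run between clusters, so edges inside a cluster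
  survive.\<close>

lemma pay:
  assumes ind: "indebted U cl k" and R: "finite R" "\<forall>r. r \<notin> R \<longrightarrow> k r = 0"
  obtains X where "X \<subseteq> {e \<in> U. cl (src e) \<noteq> cl (tgt e)}" "finite X" "card X \<le> 2 * sum k R"
    "settled (U - X) cl"
proof -
  have "\<exists>X. X \<subseteq> out U cl r \<and> card X \<le> 2 * k r \<and> tame (U - X) cl 0 r" if "r \<noteq> B" for r
  proof -
    have "tame U cl (k r) r" using ind that by (simp add: indebted_def)
    from pay_cluster[OF this that] show ?thesis by metis
  qed
  then obtain X where X: "\<And>r. r \<noteq> B \<Longrightarrow> X r \<subseteq> out U cl r" "\<And>r. r \<noteq> B \<Longrightarrow> card (X r) \<le> 2 * k r"
    "\<And>r. r \<noteq> B \<Longrightarrow> tame (U - X r) cl 0 r"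
    by metis
  \<comment> \<open>The bottom cluster is subject to no degree bound and never pays.\<close>
  define Y where "Y = (\<Union>r \<in> R - {B}. X r)"
  have "finite (X r)" if "r \<noteq> B" for r
  proof -
    have "finite (out U cl r)" using ind that by (simp add: indebted_def tame_def)
    then show ?thesis using X(1)[OF that] by (rule finite_subset[rotated])
  qed
  then have fin: "finite Y" using R by (auto simp: Y_def)
  have "card Y \<le> (\<Sum>r\<in>R - {B}. card (X r))" unfolding Y_def using R by (intro card_UN_le) auto
  also have "\<dots> \<le> (\<Sum>r\<in>R - {B}. 2 * k r)" using X(2) by (intro sum_mono) auto
  also have "\<dots> \<le> (\<Sum>r\<in>R. 2 * k r)" using R by (intro sum_mono2) auto
  finally have card: "card Y \<le> 2 * sum k R" by (simp add: sum_distrib_left)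
  have "tame (U - Y) cl 0 r" if "r \<noteq> B" for r
  proof (cases "r \<in> R")
    case True
    then show ?thesis using X(3)[OF that] that by (elim tame_antimono) (auto simp: Y_def)
  next
    case False
    then have "tame U cl 0 r" using ind that R(2) by (auto simp: indebted_def)
    then show ?thesis by (rule tame_antimono) auto
  qed
  then have "settled (U - Y) cl" using ind by (auto simp: indebted_def out_def)
  moreover have "Y \<subseteq> {e \<in> U. cl (src e) \<noteq> cl (tgt e)}"
    using X(1) by (fastforce simp: Y_def out_def)
  ultimately show thesis using that fin card by blast
qed

section \<open>Absorption into the bottom cluster\<close>

text \<open>The edges that must be deleted once the clusters in \<open>S\<close> have been absorbed into the bottom
  cluster.\<close>

definition loose :: "'e set \<Rightarrow> ('p \<Rightarrow> 'l) \<Rightarrow> 'l set \<Rightarrow> 'e set" where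
  "loose U cl S = {e \<in> U. (cl (src e) \<in> S) \<noteq> (cl (tgt e) \<in> S)
      \<and> \<not> (cl (src e) \<in> S \<and> lev (cl (tgt e)) = 1)}"

text \<open>Without credit, \<open>bad\<close> is empty at every level from 2 on; this is read off
  at both ends of the edge. The third conclusion comes from the second kind of bad edge.\<close>

lemma settled_edge:
  assumes "settled U cl" "e \<in> U" "cl (src e) \<noteq> cl (tgt e)"
  shows "lev (cl (tgt e)) \<le> Suc (lev (cl (src e)))" "lev (cl (src e)) \<le> Suc (lev (cl (tgt e)))"
    "hor e \<Longrightarrow> lev (cl (src e)) = 1 \<Longrightarrow> lev (cl (tgt e)) = 1"
    "cl (tgt e) \<noteq> B"
proof -
  have oB: "f \<in> out U cl B \<Longrightarrow> cl (src f) = B" for f using assms by (auto simp: indebted_def)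
  have nb: "e \<notin> bad U cl r" if r: "lev r \<ge> 2" for r
  proof -
    have "r \<noteq> B" using lev_B[of r] r by auto
    then have "tame U cl 0 r" using assms(1) by (simp add: indebted_def)
    then have "finite (bad U cl r)" "card (bad U cl r) \<le> 0"
      using r subs(2) finite_subset[OF subs(2)] by (auto simp: tame_def)
    then show ?thesis by auto
  qed
  have o: "e \<in> out U cl (cl (src e))" "e \<in> out U cl (cl (tgt e))" using assms by (auto simp: out_def)
  have f: "far cl (cl (src e)) e = cl (tgt e)" "far cl (cl (tgt e)) e = cl (src e)"
    using assms by (auto simp: far_def)
  show tB: "cl (tgt e) \<noteq> B" using o oB assms(3) by metis
  show "lev (cl (tgt e)) \<le> Suc (lev (cl (src e)))"
    using nb[of "cl (tgt e)"] o f by (force simp: bad_def)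
  show "lev (cl (src e)) \<le> Suc (lev (cl (tgt e)))"
    using nb[of "cl (src e)"] o f by (force simp: bad_def)
  show "lev (cl (tgt e)) = 1" if "hor e" "lev (cl (src e)) = 1"
  proof -
    have "lev (cl (tgt e)) \<noteq> 0" using tB lev_B by simp
    moreover have "\<not> lev (cl (tgt e)) \<ge> 2" using nb[of "cl (tgt e)"] o f that by (force simp: bad_def)
    ultimately show ?thesis by linarith
  qed
qed

text \<open>If \<open>e\<close> is loose, it becomes internal and at most three other edges at
  \<open>z\<close> replace it. Otherwise \<open>z\<close> has level 1 and only its at most two
  \<open>mid\<close> edges can become loose.\<close>

lemma absorb_step:
  assumes rest: "settled U cl" and S: "B \<in> S" and loose: "finite (loose U cl S)" "card (loose U cl S) \<le> m"
    and e: "e \<in> U" "{cl (src e), cl (tgt e)} = {s, z}" "s \<in> S" "z \<notin> S"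
  shows "finite (loose U cl (insert z S)) \<and> card (loose U cl (insert z S)) \<le> m + 2"
proof -
  have zB: "z \<noteq> B" using S e by auto
  then have t: "tame U cl 0 z" using rest by (simp add: indebted_def)
  then have fin: "finite (out U cl z)" "card (out U cl z) \<le> 4" by (auto simp: tame_def)
  have eo: "e \<in> out U cl z" using e by (auto simp: out_def doubleton_eq_iff)
  show ?thesis
  proof (cases "e \<in> loose U cl S")
    case True
    have sub: "loose U cl (insert z S) \<subseteq> (loose U cl S - {e}) \<union> (out U cl z - {e})"
      using e by (auto simp: loose_def out_def doubleton_eq_iff)
    have "card (loose U cl S) > 0" using True loose by (auto simp: card_gt_0_iff)
    \<comment> \<open>\<open>m\<close> bounds the size of a nonempty set, so \<open>m - 1\<close> is
      a true predecessor and (m - 1) + 3 = m + 2.\<close>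
    then have 1: "card (loose U cl S - {e}) \<le> m - 1" and "m \<noteq> 0" using True loose by auto
    have 2: "card (out U cl z - {e}) \<le> 3" using eo fin by auto
    have "card (loose U cl (insert z S)) \<le> m + 2"
      using \<open>m \<noteq> 0\<close> loose fin by (intro card_le_addI[OF sub _ _ 1 2]) auto
    then show ?thesis using loose fin finite_subset[OF sub] by simp
  next
    case False
    then have ez: "cl (src e) = s" "cl (tgt e) = z" "lev z = 1" using e by (auto simp: loose_def doubleton_eq_iff)
    have sub: "loose U cl (insert z S) \<subseteq> loose U cl S \<union> mid U cl z"
    proof
      fix f assume f: "f \<in> loose U cl (insert z S)"
      consider "f \<in> loose U cl S" | "cl (src f) = z" "cl (tgt f) \<notin> insert z S" | "cl (tgt f) = z" "cl (src f) \<notin> insert z S"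
        using f by (auto simp: loose_def)
      then show "f \<in> loose U cl S \<union> mid U cl z"
      proof cases
        case 2
        \<comment> \<open>A horizontal edge out of a level-1 cluster ends at level 1 again and is
          therefore not loose.\<close>
        then have "\<not> hor f" using settled_edge(3)[OF rest, of f] f ez by (auto simp: loose_def)
        then show ?thesis using 2 f by (auto simp: mid_def out_def loose_def)
      next
        case 3
        then have "f \<in> ins U cl z" using f by (auto simp: ins_def out_def loose_def)
        \<comment> \<open>A non-horizontal edge into \<open>z\<close> would start in
          \<open>B\<close>, which belongs to \<open>S\<close>.\<close>
        moreover have "cl (src f) \<noteq> B" using 3 S by auto
        ultimately have "hor f" using t ez by (auto simp: tame_def)
        then show ?thesis using 3 f by (auto simp: mid_def out_def loose_def)
      qed auto
    qed
    have m: "finite (mid U cl z)" "card (mid U cl z) \<le> 2"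
      using t ez finite_subset[OF subs(4) fin(1)] by (auto simp: tame_def)
    have "card (loose U cl (insert z S)) \<le> m + 2"
      using m loose by (intro card_le_addI[OF sub _ _ loose(2) m(2)]) auto
    then show ?thesis using loose m finite_subset[OF sub] by simp
  qed
qed

text \<open>\<open>Q\<close> collects the claimed edges that paid for an absorption. Each such edge
  lets the levels in \<open>S\<close> grow by at most 1 and the loose edges by at most 2. Once
  \<open>Q\<close> has maximal size, no edge of \<open>P\<close> leaves \<open>S\<close>, since it
  could be added to \<open>Q\<close>.\<close>

lemma absorb:
  assumes rest: "settled U cl" and P: "finite P" "P \<subseteq> U"
  obtains S Q where "B \<in> S" "Q \<subseteq> P" "\<And>e. e \<in> Q \<Longrightarrow> cl (src e) \<in> S \<and> cl (tgt e) \<in> S"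
    "\<And>r. r \<in> S \<Longrightarrow> lev r \<le> card Q" "finite (loose U cl S)" "card (loose U cl S) \<le> 2 * card Q"
    "\<And>e. e \<in> P \<Longrightarrow> cl (src e) \<in> S \<longleftrightarrow> cl (tgt e) \<in> S"
proof -
  define good where "good Q S \<longleftrightarrow> B \<in> S \<and> Q \<subseteq> P \<and> (\<forall>e\<in>Q. cl (src e) \<in> S \<and> cl (tgt e) \<in> S)
    \<and> (\<forall>r\<in>S. lev r \<le> card Q) \<and> finite (loose U cl S) \<and> card (loose U cl S) \<le> 2 * card Q" for Q S
  \<comment> \<open>Edges at the bottom cluster start there and end at level 1, which is exactly the
    exception in \<open>loose\<close>.\<close>
  have l0: "loose U cl {B} = {}"
  proof -
    have False if e: "e \<in> loose U cl {B}" for e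
    proof -
      have e': "e \<in> U" "cl (src e) \<noteq> cl (tgt e)" using e by (auto simp: loose_def)
      note s = settled_edge[OF rest e']
      have "cl (src e) = B" using e s(4) by (auto simp: loose_def)
      then have "lev (cl (tgt e)) = 1" using s(1,4) lev_B[of B] lev_B[of "cl (tgt e)"] by simp
      then show False using e s(4) by (auto simp: loose_def)
    qed
    then show ?thesis by auto
  qed
  have "good {} {B}" using l0 lev_B[of B] by (simp add: good_def)
  moreover have "card Q < Suc (card P)" if "good Q S" for Q S
    using that P by (auto simp: good_def less_Suc_eq_le card_mono)
  ultimately obtain Q where "\<exists>S. good Q S" and max: "\<And>Q'. \<exists>S. good Q' S \<Longrightarrow> card Q' \<le> card Q"
    using ex_has_greatest_nat[of "\<lambda>Q. \<exists>S. good Q S" "{}" card "Suc (card P)"] by (metis less_imp_le)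
  then obtain S where g: "good Q S" by blast
  have "cl (src e) \<in> S \<longleftrightarrow> cl (tgt e) \<in> S" if e: "e \<in> P" for e
  proof (rule ccontr)
    assume "(cl (src e) \<in> S) \<noteq> (cl (tgt e) \<in> S)"
    then obtain s z where sz: "{cl (src e), cl (tgt e)} = {s, z}" "s \<in> S" "z \<notin> S" by (metis insert_commute)
    have "e \<notin> Q" using g sz by (auto simp: good_def doubleton_eq_iff)
    moreover have "finite Q" using g P finite_subset by (auto simp: good_def)
    ultimately have c: "card (insert e Q) = Suc (card Q)" by simp
    have eU: "e \<in> U" using e P by auto
    have "cl (src e) \<noteq> cl (tgt e)" using sz by auto
    then have "lev z \<le> Suc (lev s)"
      using settled_edge(1,2)[OF rest eU] sz(1) by (auto simp: doubleton_eq_iff)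
    then have "lev z \<le> Suc (card Q)" using g sz by (force simp: good_def)
    moreover have "finite (loose U cl (insert z S)) \<and> card (loose U cl (insert z S)) \<le> 2 * card Q + 2"
      using g by (intro absorb_step[OF rest _ _ _ eU sz]) (auto simp: good_def)
    ultimately have "good (insert e Q) (insert z S)"
      using g sz e unfolding good_def c by (auto simp: doubleton_eq_iff le_SucI)
    then show False using max[of "insert e Q"] c by auto
  qed
  then show thesis using g by (intro that[of S Q]) (auto simp: good_def)
qed

text \<open>The edges left between \<open>S\<close> and the outside run from \<open>S\<close> to
  level 1. Clusters of higher level thus keep their neighbours' levels, and the conditions at level
  1 look at the far end only to ask whether it is \<open>B\<close>, which absorption
  preserves.\<close>

lemma settled_absorbed:
  assumes rest: "settled U cl" and S: "B \<in> S"
  shows "settled (U - loose U cl S) (\<lambda>p. if cl p \<in> S then B else cl p)"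
    (is "settled ?U ?cl")
proof -
  have "tame ?U ?cl 0 r" if r: "r \<noteq> B" for r
  proof (cases "r \<in> S")
    case True
    then have "out ?U ?cl r = {}" using r by (auto simp: out_def split: if_splits)
    then show ?thesis using r lev_B[of r] by (simp add: tame_def ins_def mid_def bad_def below_def)
  next
    case False
    have mem: "?cl p = r \<longleftrightarrow> cl p = r" for p using False r by auto
    have o: "out ?U ?cl r \<subseteq> out U cl r" by (auto simp: out_def mem)
    have i: "ins ?U ?cl r \<subseteq> ins U cl r" "mid ?U ?cl r \<subseteq> mid U cl r"
      by (auto simp: ins_def mid_def out_def mem)
    have t: "tame U cl 0 r" using rest r by (simp add: indebted_def)
    then have fin: "finite (out U cl r)" by (simp add: tame_def)
    then have fins: "finite (ins U cl r)" "finite (mid U cl r)" "finite (bad U cl r)" "finite (below U cl r)"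
      using subs finite_subset by meson+
    have "far ?cl r f = far cl r f" if f: "f \<in> out ?U ?cl r" "lev r \<noteq> 1" for f
    proof (rule ccontr)
      assume "far ?cl r f \<noteq> far cl r f"
      then have "far cl r f \<in> S" using False r by (auto simp: far_def split: if_splits)
      then show False using f False by (auto simp: out_def loose_def far_def mem split: if_splits)
    qed
    then have "lev r \<noteq> 1 \<Longrightarrow> bad ?U ?cl r \<subseteq> bad U cl r" "lev r \<noteq> 1 \<Longrightarrow> below ?U ?cl r \<subseteq> below U cl r"
      using o by (auto simp: bad_def below_def mem)
    then have "card (bad ?U ?cl r) \<le> card (bad U cl r)" "card (below ?U ?cl r) \<le> card (below U cl r)"
      if "lev r \<noteq> 1" using that fins by (auto intro: card_mono)
    moreover have "card (ins ?U ?cl r) \<le> card (ins U cl r)" "card (mid ?U ?cl r) \<le> card (mid U cl r)"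
      "card (out ?U ?cl r) \<le> card (out U cl r)"
      using i o fins fin by (auto intro: card_mono)
    moreover have "?cl (src f) = B" if "lev r = 1" "f \<in> ins ?U ?cl r" "\<not> hor f" for f
      using that i t S by (auto simp: tame_def)
    ultimately show ?thesis using t finite_subset[OF o fin] by (auto simp: tame_def)
  qed
  moreover have "?cl (src e) = B" if "e \<in> out ?U ?cl B" for e
    using that S by (auto simp: out_def loose_def split: if_splits)
  ultimately show ?thesis by (simp add: indebted_def)
qed

section \<open>Answering one turn in the abstract graph\<close>

text \<open>Absorption first, then merges, then payment: two deletions for each edge of
  \<open>Q\<close> and two for each edge of \<open>P - Q\<close>. That \<open>X\<close> runs between
  clusters of \<open>cl\<close> keeps it away from earlier claims, which lie inside them.\<close>

lemma response:
  assumes rest: "settled U cl" and P: "finite P" "P \<subseteq> U" "card P < n"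
  obtains X cl' where "X \<subseteq> U - P" "finite X" "card X \<le> 2 * card P"
    "\<forall>e \<in> X. cl (src e) \<noteq> cl (tgt e)" "settled (U - X) cl'"
    "\<forall>p q. cl p = cl q \<longrightarrow> cl' p = cl' q" "\<forall>e \<in> P. cl' (src e) = cl' (tgt e)"
    "\<forall>p. cl p = B \<longrightarrow> cl' p = B" "\<forall>p. n \<le> lev (cl p) \<longrightarrow> n \<le> lev (cl' p)"
proof -
  obtain S Q where S: "B \<in> S" "Q \<subseteq> P" "\<And>e. e \<in> Q \<Longrightarrow> cl (src e) \<in> S \<and> cl (tgt e) \<in> S"
    "\<And>r. r \<in> S \<Longrightarrow> lev r \<le> card Q" "finite (loose U cl S)" "card (loose U cl S) \<le> 2 * card Q"
    "\<And>e. e \<in> P \<Longrightarrow> cl (src e) \<in> S \<longleftrightarrow> cl (tgt e) \<in> S"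
    using absorb[OF rest P(1,2)] by metis
  define U1 where "U1 = U - loose U cl S"
  define cl1 where "cl1 = (\<lambda>p. if cl p \<in> S then B else cl p)"
  have ind: "settled U1 cl1" unfolding U1_def cl1_def by (rule settled_absorbed[OF rest S(1)])
  have PL: "P \<inter> loose U cl S = {}" using S(7) by (auto simp: loose_def)
  then have PU: "P - Q \<subseteq> U1" using P(2) by (auto simp: U1_def)
  \<comment> \<open>Label \<open>B\<close> now marks exactly the vertices with old label in
    \<open>S\<close>, and no edge of \<open>P\<close> crosses that boundary.\<close>
  have PB: "(P - Q) \<inter> out U1 cl1 B = {}" using S(1,7) by (auto simp: out_def cl1_def split: if_splits)
  have "finite (P - Q)" using P by simp
  from merge_all[OF this ind PU PB finite.emptyI]
  obtain cl' k' R' where M: "indebted U1 cl' k'" "finite R'" "\<forall>r. r \<notin> R' \<longrightarrow> k' r = 0"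
      "sum k' R' \<le> sum (\<lambda>_. 0) ({} :: 'l set) + card (P - Q)" "\<forall>p q. cl1 p = cl1 q \<longrightarrow> cl' p = cl' q"
      "\<forall>e \<in> P - Q. cl' (src e) = cl' (tgt e)" "\<forall>p. cl1 p = B \<longrightarrow> cl' p = B"
      "\<forall>p. lev (cl1 p) \<le> lev (cl' p)"
    by blast
  have "cl1 (src e) = cl1 (tgt e)" if "e \<in> Q" for e using S(3)[OF that] by (simp add: cl1_def)
  then have "cl' (src e) = cl' (tgt e)" if "e \<in> Q" for e using that M(5) by blast
  then have internal: "cl' (src e) = cl' (tgt e)" if "e \<in> P" for e using that M(6) by blast
  have "cl1 p = cl1 q" if "cl p = cl q" for p q using that by (simp add: cl1_def)
  then have coarse: "cl' p = cl' q" if "cl p = cl q" for p q using that M(5) by blast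
  obtain Y where Y: "Y \<subseteq> {e \<in> U1. cl' (src e) \<noteq> cl' (tgt e)}" "finite Y" "card Y \<le> 2 * sum k' R'"
    "settled (U1 - Y) cl'"
    by (rule pay[OF M(1-3)])
  have cQ: "card Q + card (P - Q) = card P"
    using S(2) P(1) by (metis add_diff_inverse_nat card_Diff_subset card_mono finite_subset not_less)
  show thesis
  proof (rule that[of "loose U cl S \<union> Y" cl'])
    show "loose U cl S \<union> Y \<subseteq> U - P" using PL Y(1) internal by (auto simp: loose_def U1_def)
    show "finite (loose U cl S \<union> Y)" using S Y by simp
    show "card (loose U cl S \<union> Y) \<le> 2 * card P"
      using card_Un_le[of "loose U cl S" Y] S(6) Y(3) M(4)[unfolded sum.empty] cQ by linarith
    have "cl (src e) \<noteq> cl (tgt e)" if "e \<in> loose U cl S \<union> Y" for e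
      using that Y(1) coarse[of "src e" "tgt e"] by (auto simp: loose_def)
    then show "\<forall>e \<in> loose U cl S \<union> Y. cl (src e) \<noteq> cl (tgt e)" by blast
    show "settled (U - (loose U cl S \<union> Y)) cl'"
    proof -
      have "U - (loose U cl S \<union> Y) = U1 - Y" by (auto simp: U1_def)
      then show ?thesis using Y(4) by simp
    qed
    have "n \<le> lev (cl' p)" if "n \<le> lev (cl p)" for p
    proof -
      \<comment> \<open>Absorbed clusters have level at most \<open>card Q\<close>, hence below
        \<open>n\<close>, so the top is never absorbed; merging only raises levels.\<close>
      have "card Q \<le> card P" using S(2) P(1) by (rule card_mono[rotated])
      then have "cl p \<notin> S" using S(4)[of "cl p"] that P(3) by linarith
      then show ?thesis using spec[OF M(8), of p] that by (simp add: cl1_def)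
    qed
    then show "\<forall>p. n \<le> lev (cl p) \<longrightarrow> n \<le> lev (cl' p)" by blast
    show "\<forall>p. cl p = B \<longrightarrow> cl' p = B" using M(7) S(1) by (simp add: cl1_def)
    show "\<forall>p q. cl p = cl q \<longrightarrow> cl' p = cl' q" "\<forall>e \<in> P. cl' (src e) = cl' (tgt e)"
      using coarse internal by blast+
  qed
qed

end

section \<open>The dual graph of the strip\<close>

text \<open>Indexed by the lower or left end of the dual edge: the dual of
  \<open>row_edge x h\<close> goes up from \<open>(x, h)\<close>, that of \<open>rung x h\<close>
  goes right.\<close>

definition row_edge :: "int \<Rightarrow> nat \<Rightarrow> edge" where
  "row_edge x h = {(of_int x, real h + 1), (of_int x + 1, real h + 1)}"

definition rung :: "int \<Rightarrow> nat \<Rightarrow> edge" where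
  "rung x h = {(of_int x + 1, real h), (of_int x + 1, real h + 1)}"

text \<open>The midpoint of the dual edge of \<open>e\<close> is that of \<open>e\<close>. The dual vertex \<open>(x + 1/2, h + 1/2)\<close> is
  encoded as \<open>(x, h)\<close>, and the rounding below recovers the two ends of the dual edge from the
  midpoint.\<close>

definition low :: "edge \<Rightarrow> int \<times> nat" where
  "low e = (\<lceil>fst (edge_mid e)\<rceil> - 1, nat (\<lceil>snd (edge_mid e)\<rceil> - 1))"

definition high :: "edge \<Rightarrow> int \<times> nat" where
  "high e = (\<lfloor>fst (edge_mid e)\<rfloor>, nat \<lfloor>snd (edge_mid e)\<rfloor>)"

text \<open>This concerns the dual edge: the vertical edges of the strip are the flat ones.\<close>

definition flat :: "edge \<Rightarrow> bool" where
  "flat e \<longleftrightarrow> snd (low e) = snd (high e)"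

definition dual_point :: "int \<times> nat \<Rightarrow> point" where
  "dual_point p = (of_int (fst p) + 1/2, real (snd p) + 1/2)"

lemma low_high_row_edge [simp]: "low (row_edge x h) = (x, h)" "high (row_edge x h) = (x, Suc h)"
proof -
  have m: "edge_mid (row_edge x h) = (of_int x + 1/2, real h + 1)"
    by (simp add: row_edge_def edge_mid_pair)
  have "\<lceil>real_of_int x + 1/2\<rceil> = x + 1" "\<lfloor>real_of_int x + 1/2\<rfloor> = x" by linarith+
  moreover have "\<lceil>real h + 1\<rceil> = int h + 1" "\<lfloor>real h + 1\<rfloor> = int h + 1" by linarith+
  ultimately show "low (row_edge x h) = (x, h)" "high (row_edge x h) = (x, Suc h)"
    by (simp_all add: low_def high_def m nat_add_distrib)
qed

lemma low_high_rung [simp]: "low (rung x h) = (x, h)" "high (rung x h) = (x + 1, h)"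
proof -
  have m: "edge_mid (rung x h) = (of_int x + 1, real h + 1/2)"
    by (simp add: rung_def edge_mid_pair)
  have "\<lceil>real_of_int x + 1\<rceil> = x + 1" "\<lfloor>real_of_int x + 1\<rfloor> = x + 1" by linarith+
  moreover have "\<lceil>real h + 1/2\<rceil> = int h + 1" "\<lfloor>real h + 1/2\<rfloor> = int h" by linarith+
  ultimately show "low (rung x h) = (x, h)" "high (rung x h) = (x + 1, h)"
    by (simp_all add: low_def high_def m)
qed

lemma row_edge_in_strip: "h < n \<Longrightarrow> row_edge x h \<in> strip_edges n"
proof -
  assume h: "h < n"
  have "(of_int y, real h + 1) \<in> square_lattice \<inter> strip n" for y
    using h by (auto simp: square_lattice_def strip_def image_iff intro!: bexI[of _ "Suc h"])
  from this[of x] this[of "x + 1"] show ?thesis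
    unfolding strip_edges_def unit_edges_def row_edge_def
    by (force simp: dist_Pair_Pair dist_real_def)
qed

text \<open>A vertical edge needs both ends at heights from 1 to \<open>n\<close>, so no dual edge
  runs along height 0 or height \<open>n\<close>.\<close>

lemma strip_edge_cases:
  assumes "e \<in> strip_edges n"
  obtains x h where "e = row_edge x h" "h < n" | x h where "e = rung x h" "1 \<le> h" "h < n"
proof -
  have e: "e \<in> unit_edges square_lattice" "e \<subseteq> strip n" using assms by (auto simp: strip_edges_def)
  have height: "\<exists>k. b = int k \<and> 1 \<le> k \<and> k \<le> n" if s: "(t, real_of_int b) \<in> strip n" for t b
  proof -
    obtain k where k: "real_of_int b = real k" "1 \<le> k" "k \<le> n" using s by (auto simp: strip_def)
    then have "real_of_int b = real_of_int (int k)" by simp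
    then have "b = int k" by (simp only: of_int_eq_iff)
    then show ?thesis using k by blast
  qed
  from e(1) show thesis
  proof (cases rule: lattice_edge_cases)
    case (horizontal a b)
    then obtain k where "b = int k" "1 \<le> k" "k \<le> n" using e(2) height[of "of_int a" b] by auto
    then show thesis using horizontal by (intro that(1)[of a "k - 1"]) (auto simp: row_edge_def of_nat_diff)
  next
    case (vertical a b)
    then obtain k where k: "b = int k" "1 \<le> k" using e(2) height[of "of_int a" b] by auto
    moreover have "(of_int a, real_of_int (b + 1)) \<in> strip n" using e(2) vertical by simp
    from height[OF this] have "k < n" using k by auto
    ultimately show thesis using vertical by (intro that(2)[of "a - 1" k]) (auto simp: rung_def)
  qed
qed

lemma dual_edge_low_high:
  assumes "e \<in> strip_edges n"
  shows "dual_edge e = {dual_point (low e), dual_point (high e)}"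
  using assms
proof (cases rule: strip_edge_cases)
  case (1 x h)
  then show ?thesis using dual_horizontal_edge(1)[of x "int h + 1"]
    by (simp add: row_edge_def[symmetric] dual_point_def) (simp add: row_edge_def add.commute)
next
  case (2 x h)
  then show ?thesis using dual_vertical_edge(1)[of "x + 1" "int h"]
    by (simp add: rung_def[symmetric] dual_point_def) (simp add: rung_def add.commute)
qed

lemma infinite_strip_edges:
  assumes "0 < n"
  shows "infinite (strip_edges n)"
proof
  assume "finite (strip_edges n)"
  moreover have "range (\<lambda>x. row_edge x 0) \<subseteq> strip_edges n" using assms row_edge_in_strip by auto
  ultimately have "finite (range (\<lambda>x. row_edge x 0))" by (rule finite_subset[rotated])
  moreover have "inj (\<lambda>x. row_edge x 0)" by (metis injI low_high_row_edge(1) prod.inject)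
  ultimately show False using finite_imageD infinite_UNIV_int by blast
qed

section \<open>The initial clusters\<close>

text \<open>All dual vertices of height 0 form the bottom cluster and every other one is a cluster
  by itself. The shift by one makes every \<open>Some\<close> a label of positive level.\<close>

fun label :: "int \<times> nat \<Rightarrow> (int \<times> nat) option" where
  "label (x, 0) = None"
| "label (x, Suc h) = Some (x, h)"

fun level :: "(int \<times> nat) option \<Rightarrow> nat" where
  "level None = 0"
| "level (Some (x, h)) = Suc h"

interpretation board: levelled_graph low high flat None level
  by unfold_locales (auto elim!: level.elims)

lemma level_label [simp]: "level (label p) = snd p"
  by (cases p rule: label.cases) auto

lemma label_eq_Some: "label p = Some (x, h) \<longleftrightarrow> p = (x, Suc h)"
  by (cases p rule: label.cases) auto

lemma label_eq_None: "label p = None \<longleftrightarrow> snd p = 0"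
  by (cases p rule: label.cases) auto

lemma card_insert_le_Suc: "card (insert a X) \<le> Suc (card X)"
  by (cases "finite X") (auto simp: card_insert_if)

text \<open>A single vertex has at most one edge in each of four directions: \<open>ins\<close> is
  left and down, \<open>mid\<close> left and up, \<open>below\<close> at most down. Horizontal
  neighbours have equal level, so nothing is bad above level 1.\<close>

lemma settled_start: "board.settled (strip_edges n) label"
proof -
  have flat: "flat (rung x h)" "\<not> flat (row_edge x h)" for x h by (auto simp: flat_def)
  have "board.tame (strip_edges n) label 0 r" if nN: "r \<noteq> None" for r
  proof -
    obtain x h where r: "r = Some (x, h)" using nN by auto
    let ?d = "row_edge x h" and ?u = "row_edge x (Suc h)" and ?r = "rung x (Suc h)" and ?l = "rung (x - 1) (Suc h)"
    have cases: "e \<in> {?d, ?u, ?r, ?l}" if "e \<in> board.out (strip_edges n) label r" for e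
    proof -
      have "e \<in> strip_edges n" using that by (simp add: board.out_def)
      then show ?thesis
        using that by (cases rule: strip_edge_cases) (auto simp: board.out_def r label_eq_Some)
    qed
    have out: "board.out (strip_edges n) label r \<subseteq> {?d, ?u, ?r, ?l}" using cases by auto
    have ins: "board.ins (strip_edges n) label r \<subseteq> {?d, ?l}"
      by (auto simp: board.ins_def r label_eq_Some dest!: cases[unfolded r])
    have mid: "board.mid (strip_edges n) label r \<subseteq> {?u, ?l}"
      by (auto simp: board.mid_def r label_eq_Some flat dest!: cases[unfolded r])
    have far: "level (label (low e)) = Suc h \<and> level (label (high e)) = Suc h \<or> e = ?d \<or> e = ?u"
      if "e \<in> board.out (strip_edges n) label r" for e
      using cases[OF that] by auto
    have below: "board.below (strip_edges n) label r \<subseteq> {?d}"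
    proof
      fix e assume e: "e \<in> board.below (strip_edges n) label r"
      then show "e \<in> {?d}" using far[of e] by (auto simp: board.below_def board.far_def r split: if_splits)
    qed
    have bad: "board.bad (strip_edges n) label r = {}" if "h \<noteq> 0"
    proof -
      have False if e: "e \<in> board.bad (strip_edges n) label r" for e
        using far[of e] e \<open>h \<noteq> 0\<close>
        by (auto simp: board.bad_def board.far_def r flat split: if_splits)
      then show ?thesis by auto
    qed
    have c2: "card X \<le> 2" if "X \<subseteq> {a, b}" for X :: "edge set" and a b
      using card_mono[OF _ that] card_insert_le_Suc[of a "{b}"] by simp
    have "card {?d, ?u, ?r, ?l} \<le> 4"
      using card_insert_le_Suc[of ?d "{?u, ?r, ?l}"] card_insert_le_Suc[of ?u "{?r, ?l}"]
        card_insert_le_Suc[of ?r "{?l}"] by simp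
    then have "card (board.out (strip_edges n) label r) \<le> 4" using card_mono[OF _ out] by simp
    moreover have "card (board.below (strip_edges n) label r) \<le> 2" using below by (intro c2[of _ ?d ?d]) auto
    moreover have "label (low e) = None" if "h = 0" "e \<in> board.ins (strip_edges n) label r" "\<not> flat e" for e
      using ins that flat by (auto simp: label_eq_None)
    ultimately show ?thesis
      using finite_subset[OF out] c2[OF ins] c2[OF mid] bad by (auto simp: board.tame_def r)
  qed
  moreover have "label (low e) = None" if "e \<in> board.out (strip_edges n) label None" for e
  proof -
    have "e \<in> strip_edges n" using that by (simp add: board.out_def)
    then show ?thesis
      using that by (cases rule: strip_edge_cases) (auto simp: board.out_def label_eq_None)
  qed
  ultimately show ?thesis by (simp add: board.indebted_def)
qed

section \<open>The invariant of the game and the strategy\<close>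

text \<open>Only \<open>H\<close> is deleted; the edges of \<open>V\<close> stay in the graph but
  lie inside clusters, where no bound counts them. The clustering is merely asserted to exist, so a
  strategy need not remember it.\<close>

definition safe :: "nat \<Rightarrow> edge set \<Rightarrow> edge set \<Rightarrow> bool" where
  "safe n V H \<longleftrightarrow> V \<subseteq> strip_edges n \<and> finite V \<and> finite H \<and>
    (\<exists>cl. board.settled (strip_edges n - H) cl \<and> (\<forall>e \<in> V. cl (low e) = cl (high e)) \<and>
      (\<forall>x. cl (x, 0) = None) \<and> (\<forall>x. n \<le> level (cl (x, n))))"

lemma safe_start: "safe n {} {}"
  using settled_start[of n] by (auto simp: safe_def intro!: exI[of _ label])

text \<open>\<open>board.response\<close> may use fewer than \<open>2 * card P\<close> edges,
  whereas a legal answer has exactly that many. The infinite strip supplies the rest, and further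
  deletions keep the clusters settled.\<close>

lemma safe_response:
  assumes "safe n V H" and P: "P \<subseteq> strip_edges n - (V \<union> H)" "finite P" "card P < n"
  obtains W where "W \<subseteq> strip_edges n - (V \<union> H) - P" "finite W" "card W = 2 * card P"
    "safe n (V \<union> P) (H \<union> W)"
proof -
  obtain cl where fin: "V \<subseteq> strip_edges n" "finite V" "finite H" and cl: "board.settled (strip_edges n - H) cl"
    "\<And>e. e \<in> V \<Longrightarrow> cl (low e) = cl (high e)" "\<And>x. cl (x, 0) = None" "\<And>x. n \<le> level (cl (x, n))"
    using assms by (auto simp: safe_def)
  have PU: "P \<subseteq> strip_edges n - H" using P by auto
  obtain X cl' where X: "X \<subseteq> strip_edges n - H - P" "finite X" "card X \<le> 2 * card P"
    "\<forall>e \<in> X. cl (low e) \<noteq> cl (high e)" "board.settled (strip_edges n - H - X) cl'"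
    "\<forall>p q. cl p = cl q \<longrightarrow> cl' p = cl' q" "\<forall>e \<in> P. cl' (low e) = cl' (high e)"
    "\<forall>p. cl p = None \<longrightarrow> cl' p = None" "\<forall>p. n \<le> level (cl p) \<longrightarrow> n \<le> level (cl' p)"
    by (rule board.response[OF cl(1) P(2) PU P(3)])
  have XV: "X \<inter> V = {}" using X(4) cl(2) by blast
  have "finite (V \<union> H \<union> P \<union> X)" using fin(2,3) P(2) X(2) by simp
  moreover have "infinite (strip_edges n)" using P by (intro infinite_strip_edges) auto
  ultimately have "infinite (strip_edges n - (V \<union> H \<union> P \<union> X))" by (rule Diff_infinite_finite)
  then obtain Y where Y: "finite Y" "card Y = 2 * card P - card X"
    "Y \<subseteq> strip_edges n - (V \<union> H \<union> P \<union> X)"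
    by (meson infinite_arbitrarily_large)
  have "X \<inter> Y = {}" using Y by auto
  then have card: "card (X \<union> Y) = 2 * card P" using X(2,3) Y(1,2) by (simp add: card_Un_disjoint)
  have sub: "X \<union> Y \<subseteq> strip_edges n - (V \<union> H) - P" using X(1) XV Y(3) by auto
  have "board.settled (strip_edges n - (H \<union> (X \<union> Y))) cl'"
    using X(5) by (rule board.settled_antimono) auto
  moreover have "cl' (low e) = cl' (high e)" if "e \<in> V \<union> P" for e
    using that cl(2)[of e] X(6,7) by blast
  ultimately have "safe n (V \<union> P) (H \<union> (X \<union> Y))"
    using fin P X(2,8,9) Y(1) cl(3,4) unfolding safe_def by (intro conjI exI[of _ cl']) auto
  then show thesis using that[OF sub _ card] X(2) Y(1) by blast
qed

text \<open>\<open>cl\<close> is constant along a path of duals of \<open>V\<close>, so a crossing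
  would give a top vertex the bottom label, of level 0 < n.\<close>

lemma safe_no_crossing:
  assumes "safe n V H" "0 < n"
  shows "\<not> contains_crossing n V"
proof
  assume "contains_crossing n V"
  then obtain p where p: "dual_path p" "snd (hd p) = 1/2" "snd (last p) = real n + 1/2"
    "path_edges p \<subseteq> dual_edge ` V"
    by (auto simp: contains_crossing_def crossing_dual_path_def)
  obtain cl where V: "V \<subseteq> strip_edges n" and cl: "\<And>e. e \<in> V \<Longrightarrow> cl (low e) = cl (high e)"
    "\<And>x. cl (x, 0) = None" "\<And>x. n \<le> level (cl (x, n))"
    using assms by (auto simp: safe_def)
  have ne: "p \<noteq> []" using p by (simp add: dual_path_def)
  \<comment> \<open>Rounding down decodes a dual vertex, inverting
    \<open>dual_point\<close>.\<close>
  define node where "node = (\<lambda>z :: point. (\<lfloor>fst z\<rfloor>, nat \<lfloor>snd z\<rfloor>))"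
  have node: "node (dual_point w) = w" for w
  proof -
    have "\<lfloor>real_of_int (fst w) + 1/2\<rfloor> = fst w" "\<lfloor>real (snd w) + 1/2\<rfloor> = int (snd w)" by linarith+
    then show ?thesis by (simp add: node_def dual_point_def)
  qed
  have "cl (node (p ! i)) = cl (node (p ! 0))" if "i < length p" for i
    using that
  proof (induction i)
    case (Suc i)
    then have "{p ! i, p ! Suc i} \<in> path_edges p" by (auto simp: path_edges_def)
    then obtain e where e: "e \<in> V" "{p ! i, p ! Suc i} = dual_edge e" using p by auto
    then have "{p ! i, p ! Suc i} = {dual_point (low e), dual_point (high e)}"
      using dual_edge_low_high V by blast
    then have "cl (node (p ! i)) = cl (node (p ! Suc i))"
      using cl(1)[OF e(1)] by (auto simp: doubleton_eq_iff node)
    then show ?case using Suc by simp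
  qed simp
  from this[of "length p - 1"] have "cl (node (last p)) = cl (node (hd p))"
    using ne by (simp add: last_conv_nth hd_conv_nth)
  moreover have "\<lfloor>real n + 1/2\<rfloor> = int n" by linarith
  then have "node (last p) = (\<lfloor>fst (last p)\<rfloor>, n)" "node (hd p) = (\<lfloor>fst (hd p)\<rfloor>, 0)"
    using p by (simp_all add: node_def)
  ultimately have "n \<le> level None" using cl(2,3) by metis
  then show False using assms(2) by simp
qed

theorem theorem4p1:
  fixes n q :: nat
  assumes "n \<ge> q + 1"
  shows "\<exists>\<sigma>. winning_strategy_H n q \<sigma>"
proof -
  define ok where "ok h v w \<longleftrightarrow> legal_H n h v w \<and> safe n (claimed_V h \<union> v) (claimed_H h \<union> w)" for h v w
  \<comment> \<open>Safety depends only on the claimed sets, which the history determines, so any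
    legal answer preserving it may be chosen.\<close>
  define \<sigma> where "\<sigma> h v = (SOME w. ok h v w)" for h v
  have ok: "ok h v (\<sigma> h v)" if s: "safe n (claimed_V h) (claimed_H h)" and v: "legal_V n q h v" for h v
  proof -
    \<comment> \<open>\<open>card v\<close> is at least 1, which makes \<open>v\<close> finite, and
      at most \<open>q\<close>, which is less than \<open>n\<close>.\<close>
    have v': "v \<subseteq> strip_edges n - (claimed_V h \<union> claimed_H h)" "card v < n" "finite v"
      using v assms by (auto simp: legal_V_def unclaimed_def intro: card_ge_0_finite)
    obtain w where "w \<subseteq> strip_edges n - (claimed_V h \<union> claimed_H h) - v" "finite w" "card w = 2 * card v"
      "safe n (claimed_V h \<union> v) (claimed_H h \<union> w)"
      by (rule safe_response[OF s v'(1,3,2)])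
    then have "ok h v w" by (simp add: ok_def legal_H_def unclaimed_def)
    then show ?thesis unfolding \<sigma>_def by (rule someI)
  qed
  have safe: "safe n (claimed_V h) (claimed_H h)" if "play_by n q \<sigma> h" for h
    using that
  proof induction
    case start
    show ?case using safe_start by (simp add: claimed_V_def claimed_H_def)
  next
    case (turn h v)
    have "claimed_V (h @ [(v, \<sigma> h v)]) = claimed_V h \<union> v"
      "claimed_H (h @ [(v, \<sigma> h v)]) = claimed_H h \<union> \<sigma> h v"
      by (auto simp: claimed_V_def claimed_H_def)
    then show ?case using ok[OF turn.IH turn.hyps(2)] by (simp add: ok_def)
  qed
  have "legal_H n h v (\<sigma> h v) \<and> \<not> contains_crossing n (claimed_V h \<union> v)"
    if "play_by n q \<sigma> h" "legal_V n q h v" for h v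
    using ok[OF safe[OF that(1)] that(2)] safe_no_crossing assms by (auto simp: ok_def)
  then show ?thesis unfolding winning_strategy_H_def by blast
qed

end
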